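(* Let $\kappa\in\mathbf{k}$ and let $(A,\prec,\succ,\bullet)$ be a modified tridendriform algebra of weight $\kappa$. Define $$[x,y]:=x\bullet y-y\bullet x,\qquad x\circ y:=x\succ y-y\prec x,\quad x,y\in A.$$ Then $(A,[\,,\,],\circ)$ is a modified post-Lie algebra of weight $\kappa$.
   Context: $\mathbf{k}$ is a field of characteristic $0$; all operations are bilinear. A modified tridendriform algebra of weight $\kappa$ is a vector space $A$ with three binary operations $\prec,\succ,\bullet$ such that for all $x,y,z\in A$: $(x\prec y)\prec z=x\prec(y\prec z+y\succ z)+\kappa\, x\bullet(y\bullet z)$; $(x\succ y)\prec z=x\succ(y\prec z)$; $(x\prec y+x\succ y)\succ z+\kappa\,(x\bullet y)\bullet z=x\succ(y\succ z)$; $(x\succ y)\bullet z=x\succ(y\bullet z)$; $(x\prec y)\bullet z=x\bullet(y\succ z)$; $(x\bullet y)\prec z=x\bullet(y\prec z)$; $(x\bullet y)\bullet z=x\bullet(y\bullet z)$. A modified post-Lie algebra of weight $\kappa$ is a vector space $A$ with a Lie bracket $[\,,\,]$ and a binary operation $\circ$ such that for all $x,y,z\in A$: $(x\circ y)\circ z-(y\circ x)\circ z+\kappa[[x,y],z]=x\circ(y\circ z)-y\circ(x\circ z)$ and $x\circ[y,z]=[x\circ y,z]+[y,x\circ z]$. *)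

theory Defs
  imports Complex_Main
begin

locale bilinear_operation = vector_space scale
  for scale :: "'k::field_char_0 \<Rightarrow> 'a::ab_group_add \<Rightarrow> 'a"  (infixr "*s" 75) +
  fixes mult :: "'a \<Rightarrow> 'a \<Rightarrow> 'a"
  assumes linear_left: "Vector_Spaces.linear (*s) (*s) (\<lambda>x. mult x y)"
    and linear_right: "Vector_Spaces.linear (*s) (*s) (\<lambda>y. mult x y)"

locale lie_algebra = bilinear_operation scale bracket
  for scale :: "'k::field_char_0 \<Rightarrow> 'a::ab_group_add \<Rightarrow> 'a"  (infixr "*s" 75)
    and bracket :: "'a \<Rightarrow> 'a \<Rightarrow> 'a"  ("\<lbrakk>_,/ _\<rbrakk>") +
  assumes alternating: "\<lbrakk>x, x\<rbrakk> = 0"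
    and jacobi: "\<lbrakk>x, \<lbrakk>y, z\<rbrakk>\<rbrakk> + \<lbrakk>y, \<lbrakk>z, x\<rbrakk>\<rbrakk> + \<lbrakk>z, \<lbrakk>x, y\<rbrakk>\<rbrakk> = 0"

locale modified_tridendriform_algebra =
  prec: bilinear_operation scale prec +
  succ: bilinear_operation scale succ +
  bullet: bilinear_operation scale bullet
  for scale :: "'k::field_char_0 \<Rightarrow> 'a::ab_group_add \<Rightarrow> 'a"  (infixr "*s" 75)
    and \<kappa> :: 'k
    and prec :: "'a \<Rightarrow> 'a \<Rightarrow> 'a"  (infixl "\<prec>" 78)
    and succ :: "'a \<Rightarrow> 'a \<Rightarrow> 'a"  (infixl "\<succ>" 78)
    and bullet :: "'a \<Rightarrow> 'a \<Rightarrow> 'a"  (infixl "\<bullet>" 78) +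
  assumes prec_prec: "(x \<prec> y) \<prec> z = x \<prec> (y \<prec> z + y \<succ> z) + \<kappa> *s (x \<bullet> (y \<bullet> z))"
    and succ_prec: "(x \<succ> y) \<prec> z = x \<succ> (y \<prec> z)"
    and succ_succ: "(x \<prec> y + x \<succ> y) \<succ> z + \<kappa> *s ((x \<bullet> y) \<bullet> z) = x \<succ> (y \<succ> z)"
    and succ_bullet: "(x \<succ> y) \<bullet> z = x \<succ> (y \<bullet> z)"
    and prec_bullet: "(x \<prec> y) \<bullet> z = x \<bullet> (y \<succ> z)"
    and bullet_prec: "(x \<bullet> y) \<prec> z = x \<bullet> (y \<prec> z)"
    and bullet_bullet: "(x \<bullet> y) \<bullet> z = x \<bullet> (y \<bullet> z)"

locale modified_post_lie_algebra =
  lie_algebra scale bracket +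
  circ: bilinear_operation scale circ
  for scale :: "'k::field_char_0 \<Rightarrow> 'a::ab_group_add \<Rightarrow> 'a"  (infixr "*s" 75)
    and \<kappa> :: 'k
    and bracket :: "'a \<Rightarrow> 'a \<Rightarrow> 'a"  ("\<lbrakk>_,/ _\<rbrakk>")
    and circ :: "'a \<Rightarrow> 'a \<Rightarrow> 'a"  (infixl "\<odot>" 78) +
  assumes modified_pre_lie:
      "(x \<odot> y) \<odot> z - (y \<odot> x) \<odot> z + \<kappa> *s \<lbrakk>\<lbrakk>x, y\<rbrakk>, z\<rbrakk>
         = x \<odot> (y \<odot> z) - y \<odot> (x \<odot> z)"
    and circ_derivation: "x \<odot> \<lbrakk>y, z\<rbrakk> = \<lbrakk>x \<odot> y, z\<rbrakk> + \<lbrakk>y, x \<odot> z\<rbrakk>"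

end

theory Submission imports Defs begin

text \<open>
  The bracket is the commutator of \<open>\<bullet>\<close>, and
  \<open>x \<odot> y = x \<succ> y - y \<prec> x\<close> lets \<open>x\<close> act on the left by \<open>\<succ>\<close> and, with a minus sign, on the
  right by \<open>\<prec>\<close>. Since \<open>\<bullet>\<close> is associative, its commutator is a Lie bracket
  (\<open>associative_commutator_lie\<close>). The operator \<open>y \<mapsto> x \<odot> y\<close> is a derivation of \<open>\<bullet>\<close>
  (\<open>action_derivation\<close>): the two unwanted terms, in which \<open>x\<close> stands between the two factors,
  cancel because \<open>(y \<prec> x) \<bullet> z = y \<bullet> (x \<succ> z)\<close>. A derivation of a product is a derivation of
  its commutator.

  For the modified pre-Lie identity, the left action by \<open>\<succ>\<close> and the right action by \<open>\<prec>\<close> commute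
  (\<open>succ_prec\<close>), so the mixed terms of \<open>x \<odot> (y \<odot> z)\<close> are symmetric under \<open>x \<leftrightarrow> y\<close> and vanish
  after antisymmetrization. What remains is the left action applied twice and the right action
  applied twice. Each of these is, up to a term of weight \<open>\<kappa>\<close>, the single action of
  \<open>x \<prec> y + x \<succ> y\<close> (or of \<open>y \<prec> x + y \<succ> x\<close>), and antisymmetrizing this element gives
  \<open>x \<odot> y - y \<odot> x\<close>. The weight terms become \<open>\<kappa> [x, y] \<bullet> z\<close> on the left and
  \<open>\<kappa> z \<bullet> [x, y]\<close> on the right; their difference is \<open>\<kappa> [[x, y], z]\<close>.
\<close>

context bilinear_operation
begin

lemmas add_left = module_hom.add[OF Vector_Spaces.linear.axioms(3)[OF linear_left]]
lemmas add_right = module_hom.add[OF Vector_Spaces.linear.axioms(3)[OF linear_right]]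
lemmas diff_left = module_hom.diff[OF Vector_Spaces.linear.axioms(3)[OF linear_left]]
lemmas diff_right = module_hom.diff[OF Vector_Spaces.linear.axioms(3)[OF linear_right]]

end

lemma bilinear_operation_flip:
  assumes "bilinear_operation scale f"
  shows "bilinear_operation scale (\<lambda>x y. f y x)"
proof -
  interpret bilinear_operation scale f by fact
  show ?thesis
    by (intro bilinear_operation.intro bilinear_operation_axioms.intro vector_space_axioms
        linear_right linear_left)
qed

lemma bilinear_operation_diff:
  assumes "bilinear_operation scale f" "bilinear_operation scale g"
  shows "bilinear_operation scale (\<lambda>x y. f x y - g x y)"
proof -
  interpret f: bilinear_operation scale f by fact
  interpret g: bilinear_operation scale g by fact
  interpret vector_space_pair scale scale ..
  show ?thesis
    by (intro bilinear_operation.intro bilinear_operation_axioms.intro f.vector_space_axioms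
        linear_compose_sub f.linear_left f.linear_right g.linear_left g.linear_right)
qed

lemma associative_commutator_lie:
  assumes "bilinear_operation scale f"
    and assoc: "\<And>x y z. f (f x y) z = f x (f y z)"
  shows "lie_algebra scale (\<lambda>x y. f x y - f y x)"
proof -
  interpret f: bilinear_operation scale f by fact
  interpret c: bilinear_operation scale "\<lambda>x y. f x y - f y x"
    by (rule bilinear_operation_diff[OF assms(1) bilinear_operation_flip[OF assms(1)]])
  show ?thesis
    by unfold_locales (simp_all add: f.diff_left f.diff_right assoc)
qed

context modified_tridendriform_algebra
begin

text \<open>
  The terms \<open>(y \<prec> x) \<bullet> z\<close> and \<open>y \<bullet> (x \<succ> z)\<close> on the right-hand side are equal and cancel.
\<close>
lemma action_derivation:
  "x \<succ> (y \<bullet> z) - (y \<bullet> z) \<prec> x = (x \<succ> y - y \<prec> x) \<bullet> z + y \<bullet> (x \<succ> z - z \<prec> x)"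
  by (simp add: bullet.diff_left bullet.diff_right succ_bullet prec_bullet bullet_prec)

lemma action_derivation_commutator:
  "x \<succ> (y \<bullet> z - z \<bullet> y) - (y \<bullet> z - z \<bullet> y) \<prec> x
   = ((x \<succ> y - y \<prec> x) \<bullet> z - z \<bullet> (x \<succ> y - y \<prec> x))
     + (y \<bullet> (x \<succ> z - z \<prec> x) - (x \<succ> z - z \<prec> x) \<bullet> y)"
proof -
  have "x \<succ> (y \<bullet> z - z \<bullet> y) - (y \<bullet> z - z \<bullet> y) \<prec> x
      = (x \<succ> (y \<bullet> z) - (y \<bullet> z) \<prec> x) - (x \<succ> (z \<bullet> y) - (z \<bullet> y) \<prec> x)"
    by (simp add: succ.diff_right prec.diff_left)
  also have "\<dots> = ((x \<succ> y - y \<prec> x) \<bullet> z - z \<bullet> (x \<succ> y - y \<prec> x))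
      + (y \<bullet> (x \<succ> z - z \<prec> x) - (x \<succ> z - z \<prec> x) \<bullet> y)"
    unfolding action_derivation by simp
  finally show ?thesis .
qed

text \<open>
  The mixed terms cancel because \<open>x \<succ> (z \<prec> y) = (x \<succ> z) \<prec> y\<close>, that is, because the left and
  the right action commute.
\<close>
lemma action_commutator:
  "(x \<succ> (y \<succ> z - z \<prec> y) - (y \<succ> z - z \<prec> y) \<prec> x)
    - (y \<succ> (x \<succ> z - z \<prec> x) - (x \<succ> z - z \<prec> x) \<prec> y)
   = (x \<succ> (y \<succ> z) - y \<succ> (x \<succ> z)) - ((z \<prec> x) \<prec> y - (z \<prec> y) \<prec> x)"
  by (simp add: succ.diff_right prec.diff_left succ_prec)

text \<open>
  Acting successively by \<open>y\<close> and \<open>x\<close> is acting by \<open>x \<prec> y + x \<succ> y\<close>, up to a weight term;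
  antisymmetrizing this element in \<open>x\<close> and \<open>y\<close> gives \<open>x \<odot> y - y \<odot> x\<close>. The same element
  governs the right action in \<open>prec_prec_commutator\<close>.
\<close>
lemma succ_succ_commutator:
  "x \<succ> (y \<succ> z) - y \<succ> (x \<succ> z)
   = ((x \<succ> y - y \<prec> x) - (y \<succ> x - x \<prec> y)) \<succ> z + \<kappa> *s ((x \<bullet> y - y \<bullet> x) \<bullet> z)"
  by (simp add: succ_succ[symmetric] succ.add_left succ.diff_left bullet.diff_left algebra_simps)

lemma prec_prec_commutator:
  "(z \<prec> x) \<prec> y - (z \<prec> y) \<prec> x
   = z \<prec> ((x \<succ> y - y \<prec> x) - (y \<succ> x - x \<prec> y)) + \<kappa> *s (z \<bullet> (x \<bullet> y - y \<bullet> x))"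
  by (simp add: prec_prec prec.add_right prec.diff_right bullet.diff_right algebra_simps)

end

theorem corollary2p15:
  fixes scale :: "'k::field_char_0 \<Rightarrow> 'a::ab_group_add \<Rightarrow> 'a"
    and \<kappa> :: 'k
    and prec succ bullet :: "'a \<Rightarrow> 'a \<Rightarrow> 'a"
  assumes "modified_tridendriform_algebra scale \<kappa> prec succ bullet"
  shows "modified_post_lie_algebra scale \<kappa>
           (\<lambda>x y. bullet x y - bullet y x)
           (\<lambda>x y. succ x y - prec y x)"
proof -
  interpret modified_tridendriform_algebra scale \<kappa> prec succ bullet by fact
  interpret lie: lie_algebra scale "\<lambda>x y. bullet x y - bullet y x"
    by (rule associative_commutator_lie[OF bullet.bilinear_operation_axioms bullet_bullet])
  interpret circ: bilinear_operation scale "\<lambda>x y. succ x y - prec y x"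
    by (rule bilinear_operation_diff[OF succ.bilinear_operation_axioms
        bilinear_operation_flip[OF prec.bilinear_operation_axioms]])
  show ?thesis
  proof (unfold_locales, goal_cases)
    case (1 x y z)
    show ?case
      unfolding action_commutator succ_succ_commutator prec_prec_commutator
      by (simp add: succ.add_left succ.diff_left prec.add_right prec.diff_right algebra_simps)
  next
    case (2 x y z)
    show ?case
      by (rule action_derivation_commutator)
  qed
qed

end
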